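(* Let $0\le\alpha<1$ and $0\le x_1<x_2\le1$, let $\mathcal{M}=\mathcal{M}_{\alpha,x_1,x_2}$ be the piecewise linear transformation of $[0,1)$ defined in the context, with $\mathbf H=[x_1,x_2)$, and let $\mathcal{S}$ be its maximal invariant set. Then there exists a non-negative integer $N$ such that $$\mathcal{S}=\mathcal{M}^N([0,1))\setminus\mathbf H.$$
   Context: $\langle x\rangle=x-\lfloor x\rfloor$ is the fractional part of $x$. For $0\le\alpha<1$ and $0\le x_1<x_2\le 1$ put $U=[0,x_1)$, $\mathbf H=[x_1,x_2)$, $V=[x_2,1)$. The map $\mathcal{M}=\mathcal{M}_{\alpha,x_1,x_2}:[0,1)\to[0,1)$ is $\mathcal{M}(t)=\langle t+\alpha+x_2-x_1\rangle$ for $t\in U$, $\mathcal{M}(t)=t$ for $t\in\mathbf H$, $\mathcal{M}(t)=\langle t+\alpha\rangle$ for $t\in V$. The maximal invariant set $\mathcal{S}$ of $\mathcal{M}$ is the largest set $\mathcal{S}\subset[0,1)\setminus\mathbf H$ with $\mathcal{M}(\mathcal{S})=\mathcal{S}$. $\mathcal{M}^N$ is the $N$-fold iterate. *)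

theory Defs
  imports Complex_Main
begin

definition hole :: "real \<Rightarrow> real \<Rightarrow> real set" where
  "hole x\<^sub>1 x\<^sub>2 = {x\<^sub>1..<x\<^sub>2}"

text \<open>
  The map acts on \<open>[0,1)\<close>. On \<open>[0,1)\<close> the last branch is exactly \<open>[x\<^sub>2,1)\<close>;
  the values at reals outside \<open>[0,1)\<close> are irrelevant, as only images of subsets of
  \<open>[0,1)\<close> are considered below.
\<close>

definition pl_map :: "real \<Rightarrow> real \<Rightarrow> real \<Rightarrow> real \<Rightarrow> real" where
  "pl_map \<alpha> x\<^sub>1 x\<^sub>2 t =
     (if t \<in> {0..<x\<^sub>1} then frac (t + \<alpha> + x\<^sub>2 - x\<^sub>1)
      else if t \<in> hole x\<^sub>1 x\<^sub>2 then t
      else frac (t + \<alpha>))"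

definition max_invariant_set :: "real \<Rightarrow> real \<Rightarrow> real \<Rightarrow> real set" where
  "max_invariant_set \<alpha> x\<^sub>1 x\<^sub>2 =
     (GREATEST S. S \<subseteq> {0..<1} - hole x\<^sub>1 x\<^sub>2 \<and> pl_map \<alpha> x\<^sub>1 x\<^sub>2 ` S = S)"

text \<open>The greatest such set exists, so the description above is meaningful.\<close>

lemma max_invariant_set_eq_Union:
  "max_invariant_set \<alpha> x\<^sub>1 x\<^sub>2 =
     \<Union> {S. S \<subseteq> {0..<1} - hole x\<^sub>1 x\<^sub>2 \<and> pl_map \<alpha> x\<^sub>1 x\<^sub>2 ` S = S}"
  unfolding max_invariant_set_def
proof (rule Greatest_equality)
  let ?F = "{S. S \<subseteq> {0..<1} - hole x\<^sub>1 x\<^sub>2 \<and> pl_map \<alpha> x\<^sub>1 x\<^sub>2 ` S = S}"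
  have "pl_map \<alpha> x\<^sub>1 x\<^sub>2 ` \<Union> ?F = (\<Union>S\<in>?F. pl_map \<alpha> x\<^sub>1 x\<^sub>2 ` S)"
    by (rule image_Union)
  also have "\<dots> = (\<Union>S\<in>?F. S)"
    by (rule SUP_cong) auto
  finally show "\<Union> ?F \<subseteq> {0..<1} - hole x\<^sub>1 x\<^sub>2 \<and> pl_map \<alpha> x\<^sub>1 x\<^sub>2 ` \<Union> ?F = \<Union> ?F"
    by auto
qed auto

lemma max_invariant_set_subset:
  "max_invariant_set \<alpha> x\<^sub>1 x\<^sub>2 \<subseteq> {0..<1} - hole x\<^sub>1 x\<^sub>2"
  unfolding max_invariant_set_eq_Union by blast

lemma max_invariant_set_invariant:
  "pl_map \<alpha> x\<^sub>1 x\<^sub>2 ` max_invariant_set \<alpha> x\<^sub>1 x\<^sub>2 = max_invariant_set \<alpha> x\<^sub>1 x\<^sub>2"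
  unfolding max_invariant_set_eq_Union by (subst image_Union) auto

lemma max_invariant_set_greatest:
  assumes "S \<subseteq> {0..<1} - hole x\<^sub>1 x\<^sub>2" and "pl_map \<alpha> x\<^sub>1 x\<^sub>2 ` S = S"
  shows "S \<subseteq> max_invariant_set \<alpha> x\<^sub>1 x\<^sub>2"
  unfolding max_invariant_set_eq_Union using assms by blast

lemma pl_map_in_unit:
  assumes "t \<in> {0..<1}"
  shows "pl_map \<alpha> x\<^sub>1 x\<^sub>2 t \<in> {0..<1}"
  using assms by (auto simp: pl_map_def frac_lt_1)

end

theory Submission
  imports Defs
begin

text \<open>
  Off the hole \<open>H\<close> the map \<open>M\<close> is injective, and its image misses exactly an arc \<open>J\<close> of
  the same length \<open>\<delta> = x\<^sub>2 - x\<^sub>1\<close>. A point is missing from \<open>M\<^sup>N([0,1))\<close>, \<open>H\<close> aside, exactly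
  when it lies on the forward orbit of \<open>J\<close>, at time less than \<open>N\<close>; so everything hinges on
  \<open>J\<close> falling into \<open>H\<close> in bounded time. Each of the finitely many breakpoints of \<open>M\<close> has at most one
  preimage in \<open>J\<close> along orbits avoiding \<open>H\<close>. These preimages cut \<open>J\<close> into finitely many intervals,
  each of which moves rigidly until it is swallowed by \<open>H\<close>; one that never is would produce
  infinitely many disjoint intervals of equal length in \<open>[0,1)\<close>. The inverse map is of the same
  kind, with \<open>H\<close> and \<open>J\<close> exchanged, and so every point of \<open>H\<close> comes from \<open>J\<close>; hence no point
  that has an infinite backward orbit outside \<open>H\<close> is ever mapped into \<open>H\<close>.
\<close>

section \<open>Entry times into the hole for injective piecewise translations\<close>

text \<open>\<open>D\<close> holds the breakpoints of \<open>T\<close>, and \<open>L\<close> the left endpoints of the components of \<open>J\<close>.\<close>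

locale interval_escape =
  fixes T :: "real \<Rightarrow> real" and X H J D L :: "real set"
  assumes X_unit: "X \<subseteq> {0..<1}"
    and J_sub: "J \<subseteq> X"
    and T_closed: "t \<in> X \<Longrightarrow> t \<notin> H \<Longrightarrow> T t \<in> X"
    and T_notin: "t \<in> X \<Longrightarrow> t \<notin> H \<Longrightarrow> T t \<notin> J"
    and T_inj: "inj_on T (X - H)"
    and finite_D: "finite D"
    and H_rigid: "s \<in> X \<Longrightarrow> t \<in> X \<Longrightarrow> s < t \<Longrightarrow> {s<..t} \<inter> D = {} \<Longrightarrow> t \<in> H \<longleftrightarrow> s \<in> H"
    and T_rigid: "s \<in> X \<Longrightarrow> t \<in> X \<Longrightarrow> s < t \<Longrightarrow> {s<..t} \<inter> D = {} \<Longrightarrow> s \<notin> H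
                    \<Longrightarrow> T t = T s + (t - s)"
    and J_right_open: "p \<in> J \<Longrightarrow> \<exists>e>0. {p..<p + e} \<subseteq> J"
    and finite_L: "finite L"
    and L_sub: "L \<subseteq> J"
    and L_left: "t \<in> J \<Longrightarrow> \<exists>l\<in>L. l \<le> t \<and> {l..t} \<subseteq> J"
begin

text \<open>The bound on \<open>i\<close> is strict, so \<open>(T ^^ n) p\<close> may already lie in
  \<open>H\<close>: the moment of entry is still covered.\<close>

definition survives :: "nat \<Rightarrow> real \<Rightarrow> bool" where
  "survives n p \<longleftrightarrow> (\<forall>i<n. (T ^^ i) p \<notin> H)"

lemma survives_Suc: "survives (Suc n) p \<longleftrightarrow> survives n p \<and> (T ^^ n) p \<notin> H"
  unfolding survives_def by (auto simp: less_Suc_eq)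

lemma survives_0 [simp]: "survives 0 p"
  by (simp add: survives_def)

lemma orbit_in: "p \<in> X \<Longrightarrow> survives n p \<Longrightarrow> (T ^^ n) p \<in> X"
  by (induction n) (auto simp: survives_Suc T_closed)

text \<open>Cancelling \<open>T\<close>, injective off \<open>H\<close>, on both sides leads to time
  0 on one of them; if time remained on the other, a point of \<open>J\<close> would be an image,
  against \<open>T_notin\<close>.\<close>

lemma orbits_disjoint:
  assumes "p \<in> J" "q \<in> J" "survives n p" "survives m q" "(T ^^ n) p = (T ^^ m) q"
  shows "n = m \<and> p = q"
  using assms(3-5)
proof (induction n arbitrary: m)
  case 0
  show ?case
  proof (cases m)
    case 0
    then show ?thesis using "0.prems" by simp
  next
    case (Suc k)
    then have "p = T ((T ^^ k) q)" "survives k q" "(T ^^ k) q \<notin> H"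
      using "0.prems" by (auto simp: survives_Suc)
    then show ?thesis
      using T_notin orbit_in assms(1,2) J_sub by (metis subsetD)
  qed
next
  case (Suc n)
  have n: "survives n p" "(T ^^ n) p \<notin> H" "(T ^^ n) p \<in> X"
    using Suc.prems orbit_in assms(1) J_sub by (auto simp: survives_Suc)
  show ?case
  proof (cases m)
    case 0
    then have "q = T ((T ^^ n) p)" using Suc.prems by simp
    then show ?thesis using T_notin n assms(2) by metis
  next
    case m: (Suc k)
    have k: "survives k q" "(T ^^ k) q \<notin> H" "(T ^^ k) q \<in> X"
      using Suc.prems m orbit_in assms(2) J_sub by (auto simp: survives_Suc)
    have "(T ^^ n) p = (T ^^ k) q"
      using T_inj n k Suc.prems(3) m by (auto dest: inj_onD)
    then show ?thesis using Suc.IH n k m by auto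
  qed
qed

definition cuts :: "real set" where
  "cuts = {p \<in> J. \<exists>n. survives n p \<and> (T ^^ n) p \<in> D}"

lemma finite_cuts: "finite cuts"
proof -
  \<comment> \<open>\<open>g p\<close> is a breakpoint hit by \<open>p\<close>; by
    \<open>orbits_disjoint\<close>, distinct cuts hit distinct breakpoints.\<close>
  define g where "g p = (T ^^ (SOME n. survives n p \<and> (T ^^ n) p \<in> D)) p" for p
  have g: "\<exists>n. survives n p \<and> g p = (T ^^ n) p \<and> g p \<in> D" if "p \<in> cuts" for p
    using that someI_ex[of "\<lambda>n. survives n p \<and> (T ^^ n) p \<in> D"]
    unfolding cuts_def g_def by blast
  have "inj_on g cuts"
  proof (rule inj_onI)
    fix p q assume "p \<in> cuts" "q \<in> cuts" "g p = g q"
    then show "p = q"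
      using g[of p] g[of q] orbits_disjoint[of p q] by (auto simp: cuts_def)
  qed
  moreover have "g ` cuts \<subseteq> D" using g by blast
  ultimately show ?thesis
    using finite_D by (meson finite_imageD finite_subset)
qed

text \<open>A breakpoint separating the orbits of \<open>p\<close> and \<open>q\<close> would be hit
  by some point of \<open>{p<..t}\<close>, which would then be a cut.\<close>

lemma rigid_motion:
  assumes sub: "{p..t} \<subseteq> J" and cuts: "{p<..t} \<inter> cuts = {}"
    and "survives n p" "q \<in> {p..t}"
  shows "survives n q \<and> (T ^^ n) q = (T ^^ n) p + (q - p) \<and> ((T ^^ n) q \<in> H \<longleftrightarrow> (T ^^ n) p \<in> H)"
proof -
  have no_break: "{(T ^^ n) p<..(T ^^ n) q} \<inter> D = {}"
    and same_hole: "(T ^^ n) q \<in> H \<longleftrightarrow> (T ^^ n) p \<in> H"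
    if rigid: "\<And>r. r \<in> {p..t} \<Longrightarrow> survives n r \<and> (T ^^ n) r = (T ^^ n) p + (r - p)"
      and q: "q \<in> {p..t}" for n q
  proof -
    show no_break: "{(T ^^ n) p<..(T ^^ n) q} \<inter> D = {}"
    proof (rule ccontr)
      assume "{(T ^^ n) p<..(T ^^ n) q} \<inter> D \<noteq> {}"
      then obtain d where d: "d \<in> D" "d \<in> {(T ^^ n) p<..(T ^^ n) q}" by blast
      define u where "u = p + (d - (T ^^ n) p)"
      have u: "u \<in> {p<..t}" using d rigid[OF q] q by (auto simp: u_def)
      then have "survives n u" "(T ^^ n) u = d"
        using rigid[of u] by (auto simp: u_def)
      then have "u \<in> cuts" using u d sub by (auto simp: cuts_def)
      then show False using u cuts by blast
    qed
    have "p \<in> {p..t}" using q by auto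
    then have "(T ^^ n) p \<in> X" "(T ^^ n) q \<in> X"
      using orbit_in rigid q sub J_sub by blast+
    then show "(T ^^ n) q \<in> H \<longleftrightarrow> (T ^^ n) p \<in> H"
      using H_rigid[of "(T ^^ n) p" "(T ^^ n) q"] no_break rigid[OF q] q by (cases "q = p") auto
  qed
  have rigid: "survives n r \<and> (T ^^ n) r = (T ^^ n) p + (r - p)"
    if "survives n p" "r \<in> {p..t}" for n r
    using that
  proof (induction n arbitrary: r)
    case 0
    then show ?case by simp
  next
    case (Suc n)
    have n: "survives n p" "(T ^^ n) p \<notin> H" using Suc.prems by (auto simp: survives_Suc)
    note IH = Suc.IH[OF n(1)]
    have r: "survives n r" "(T ^^ n) r = (T ^^ n) p + (r - p)" "(T ^^ n) r \<notin> H"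
      using IH[OF Suc.prems(2)] same_hole[OF IH Suc.prems(2)] n(2) by auto
    have "p \<in> {p..t}" using Suc.prems(2) by auto
    then have "(T ^^ n) p \<in> X" "(T ^^ n) r \<in> X"
      using orbit_in n r Suc.prems(2) sub J_sub by blast+
    then show ?case
      using T_rigid[of "(T ^^ n) p" "(T ^^ n) r"] no_break[OF IH Suc.prems(2)] r n Suc.prems(2)
      by (cases "r = p") (auto simp: survives_Suc)
  qed
  show ?thesis
    using rigid[OF assms(3,4)] same_hole[OF rigid[OF assms(3)] assms(4)] by blast
qed

text \<open>If \<open>p\<close> is never absorbed, pigeonhole brings two of its iterates closer than
  the width of a rigidly moving interval that starts at \<open>p\<close>. Some \<open>q\<close> in
  it then reaches \<open>(T ^^ m) p\<close> at a time \<open>n\<close> other than \<open>m\<close>,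
  against \<open>orbits_disjoint\<close>.\<close>

lemma enters_hole:
  assumes "p \<in> J"
  shows "\<exists>n. (T ^^ n) p \<in> H"
proof (rule ccontr)
  assume "\<nexists>n. (T ^^ n) p \<in> H"
  then have surv: "survives n p" for n by (auto simp: survives_def)
  obtain e0 where e0: "e0 > 0" "{p..<p + e0} \<subseteq> J" using J_right_open assms by blast
  \<comment> \<open>Inserting \<open>p + e0\<close> keeps the set nonempty when no cut lies to the
    right of \<open>p\<close>, and keeps \<open>{p..<r}\<close> inside \<open>J\<close>.\<close>
  define r where "r = Min (insert (p + e0) {q \<in> cuts. p < q})"
  have fin: "finite (insert (p + e0) {q \<in> cuts. p < q})" using finite_cuts by auto
  have r: "p < r" "r \<le> p + e0" using fin e0 by (auto simp: r_def)
  have r_cut: "r \<le> q" if "q \<in> cuts" "p < q" for q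
    unfolding r_def using that fin by auto
  define e where "e = r - p"
  have e: "e > 0" using r by (simp add: e_def)
  \<comment> \<open>The floors number cells of width \<open>e\<close>, only finitely many of which
    meet the unit interval.\<close>
  have "range (\<lambda>n. \<lfloor>(T ^^ n) p / e\<rfloor>) \<subseteq> {0..\<lfloor>1 / e\<rfloor>}"
  proof clarify
    fix n
    have "(T ^^ n) p \<in> {0..<1}" using orbit_in surv assms J_sub X_unit by blast
    then show "\<lfloor>(T ^^ n) p / e\<rfloor> \<in> {0..\<lfloor>1 / e\<rfloor>}"
      using e by (auto intro!: floor_mono divide_right_mono)
  qed
  then have "finite (range (\<lambda>n. \<lfloor>(T ^^ n) p / e\<rfloor>))" by (rule finite_subset) simp
  then have "\<not> inj (\<lambda>n. \<lfloor>(T ^^ n) p / e\<rfloor>)"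
    using finite_imageD infinite_UNIV_nat by blast
  then obtain n m where nm: "n \<noteq> m" "\<lfloor>(T ^^ n) p / e\<rfloor> = \<lfloor>(T ^^ m) p / e\<rfloor>"
    by (auto simp: inj_def)
  obtain n m where nm: "n \<noteq> m" "\<lfloor>(T ^^ n) p / e\<rfloor> = \<lfloor>(T ^^ m) p / e\<rfloor>" "(T ^^ n) p \<le> (T ^^ m) p"
    using nm by (metis linorder_le_cases)
  have "(T ^^ m) p / e - (T ^^ n) p / e < 1" using nm(2) by linarith
  then have lt: "(T ^^ m) p - (T ^^ n) p < e" using e by (simp add: field_simps)
  define q where "q = p + ((T ^^ m) p - (T ^^ n) p)"
  have q: "p \<le> q" "q < r" using nm(3) lt by (auto simp: q_def e_def)
  have "{p..q} \<subseteq> J" "{p<..q} \<inter> cuts = {}"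
    using q r e0 r_cut by fastforce+
  then have "survives n q" "(T ^^ n) q = (T ^^ m) p" "q \<in> J"
    using rigid_motion[of p q n q] surv q by (auto simp: q_def)
  then show False
    using orbits_disjoint[of q p n m] assms surv nm(1) by auto
qed

text \<open>Each point of \<open>J\<close> moves rigidly with the nearest point of the finite set
  \<open>P\<close> at or to the left of it, so it is in \<open>H\<close> at the entry time of that
  point.\<close>

lemma enters_hole_bounded: "\<exists>N. \<forall>t\<in>J. \<exists>n\<le>N. (T ^^ n) t \<in> H"
proof -
  define P where "P = cuts \<union> L"
  have P: "finite P" "P \<subseteq> J"
    using finite_cuts finite_L L_sub by (auto simp: P_def cuts_def)
  define h where "h p = (LEAST n. (T ^^ n) p \<in> H)" for p
  show ?thesis
  proof (rule exI[of _ "Max (h ` P)"], rule ballI)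
    fix t assume t: "t \<in> J"
    obtain l where l: "l \<in> L" "l \<le> t" "{l..t} \<subseteq> J" using L_left t by blast
    define p where "p = Max {q \<in> P. q \<le> t}"
    have fin: "finite {q \<in> P. q \<le> t}" "{q \<in> P. q \<le> t} \<noteq> {}"
      using P l by (auto simp: P_def)
    have p: "p \<in> P" "p \<le> t" using Max_in[OF fin] by (auto simp: p_def)
    have p_max: "q \<le> p" if "q \<in> P" "q \<le> t" for q
      unfolding p_def using fin that by auto
    have "l \<le> p" using p_max l by (auto simp: P_def)
    then have sub: "{p..t} \<subseteq> J" using l by auto
    have nocut: "{p<..t} \<inter> cuts = {}" using p_max by (force simp: P_def)
    have "(T ^^ h p) p \<in> H"
      unfolding h_def by (rule LeastI_ex) (use enters_hole p P in blast)
    moreover have "survives (h p) p"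
      unfolding survives_def h_def using not_less_Least by blast
    ultimately have "(T ^^ h p) t \<in> H"
      using rigid_motion[OF sub nocut, of "h p" t] p by auto
    moreover have "h p \<le> Max (h ` P)" using P p by auto
    ultimately show "\<exists>n\<le>Max (h ` P). (T ^^ n) t \<in> H" by blast
  qed
qed

end

section \<open>The given map off its hole, and its inverse\<close>

text \<open>The arc \<open>[\<alpha>, \<alpha> + \<delta>)\<close> of the circle, wrapped into \<open>[0,1)\<close>.\<close>

definition gap :: "real \<Rightarrow> real \<Rightarrow> real set" where
  "gap \<alpha> \<delta> = {\<alpha>..<min 1 (\<alpha> + \<delta>)} \<union> {0..<\<alpha> + \<delta> - 1}"

text \<open>\<open>u\<close> undoes the rotation by \<alpha>; the branches then undo the shift of
  the left piece. On the gap, which nothing off the hole reaches, the default value is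
  \<open>y\<close>.\<close>

definition pl_inv :: "real \<Rightarrow> real \<Rightarrow> real \<Rightarrow> real \<Rightarrow> real" where
  "pl_inv \<alpha> x\<^sub>1 x\<^sub>2 y =
     (let u = (if \<alpha> \<le> y then y - \<alpha> else y - \<alpha> + 1)
      in if u < x\<^sub>2 - x\<^sub>1 then y else if u < x\<^sub>2 then u - (x\<^sub>2 - x\<^sub>1) else u)"

lemma frac_below_2:
  fixes u :: real
  assumes "0 \<le> u" "u < 2"
  shows "frac u = (if u < 1 then u else u - 1)"
proof -
  have "\<lfloor>u\<rfloor> = (if u < 1 then 0 else 1)" using assms by (auto simp: floor_eq_iff)
  then show ?thesis by (auto simp: frac_def)
qed

context
  fixes \<alpha> x\<^sub>1 x\<^sub>2 :: real
  assumes params: "0 \<le> \<alpha>" "\<alpha> < 1" "0 \<le> x\<^sub>1" "x\<^sub>1 < x\<^sub>2" "x\<^sub>2 \<le> 1"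
begin

text \<open>Shifting the left piece by \<open>x\<^sub>2 - x\<^sub>1\<close> closes the hole and
  vacates an arc at 0; the rotation by \<alpha> carries that arc to the gap.\<close>

lemma pl_map_off_hole:
  assumes "t \<in> {0..<1}" "t \<notin> hole x\<^sub>1 x\<^sub>2"
  shows "pl_map \<alpha> x\<^sub>1 x\<^sub>2 t =
    (let u = (if t < x\<^sub>1 then t + (x\<^sub>2 - x\<^sub>1) else t) + \<alpha> in if u < 1 then u else u - 1)"
  using assms params unfolding pl_map_def hole_def
  by (auto simp: frac_below_2 Let_def algebra_simps)

lemma pl_map_on_hole: "t \<in> hole x\<^sub>1 x\<^sub>2 \<Longrightarrow> pl_map \<alpha> x\<^sub>1 x\<^sub>2 t = t"
  by (auto simp: pl_map_def hole_def)

lemma pl_map_notin_gap: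
  assumes "t \<in> {0..<1}" "t \<notin> hole x\<^sub>1 x\<^sub>2"
  shows "pl_map \<alpha> x\<^sub>1 x\<^sub>2 t \<notin> gap \<alpha> (x\<^sub>2 - x\<^sub>1)"
  unfolding pl_map_off_hole[OF assms] using assms params
  by (auto simp: gap_def hole_def Let_def split: if_splits)

lemma pl_inv_pl_map:
  assumes "t \<in> {0..<1}" "t \<notin> hole x\<^sub>1 x\<^sub>2"
  shows "pl_inv \<alpha> x\<^sub>1 x\<^sub>2 (pl_map \<alpha> x\<^sub>1 x\<^sub>2 t) = t"
  unfolding pl_map_off_hole[OF assms] pl_inv_def using assms params
  by (auto simp: hole_def Let_def split: if_splits)

lemma pl_inv_off_gap:
  assumes "y \<in> {0..<1}" "y \<notin> gap \<alpha> (x\<^sub>2 - x\<^sub>1)"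
  shows "pl_inv \<alpha> x\<^sub>1 x\<^sub>2 y \<in> {0..<1}" "pl_inv \<alpha> x\<^sub>1 x\<^sub>2 y \<notin> hole x\<^sub>1 x\<^sub>2"
  unfolding pl_inv_def using assms params
  by (auto simp: hole_def gap_def Let_def split: if_splits)

lemma pl_map_pl_inv:
  assumes "y \<in> {0..<1}" "y \<notin> gap \<alpha> (x\<^sub>2 - x\<^sub>1)"
  shows "pl_map \<alpha> x\<^sub>1 x\<^sub>2 (pl_inv \<alpha> x\<^sub>1 x\<^sub>2 y) = y"
  unfolding pl_map_off_hole[OF pl_inv_off_gap[OF assms]]
  unfolding pl_inv_def using assms params
  by (auto simp: gap_def Let_def split: if_splits)

text \<open>Branches change at \<open>x\<^sub>1\<close> and \<open>x\<^sub>2\<close>; the other two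
  breakpoints are where the right and the left piece wrap around 1. A gap that wraps has a second
  component, starting at 0.\<close>

lemma forward_escape:
  "interval_escape (pl_map \<alpha> x\<^sub>1 x\<^sub>2) {0..<1} (hole x\<^sub>1 x\<^sub>2) (gap \<alpha> (x\<^sub>2 - x\<^sub>1))
     {x\<^sub>1, x\<^sub>2, 1 - \<alpha>, 1 - \<alpha> - (x\<^sub>2 - x\<^sub>1)} ({0, \<alpha>} \<inter> gap \<alpha> (x\<^sub>2 - x\<^sub>1))"
proof
  show "inj_on (pl_map \<alpha> x\<^sub>1 x\<^sub>2) ({0..<1} - hole x\<^sub>1 x\<^sub>2)"
    by (rule inj_on_inverseI[where g = "pl_inv \<alpha> x\<^sub>1 x\<^sub>2"]) (auto simp: pl_inv_pl_map)
next
  fix s t :: real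
  assume st: "s \<in> {0..<1}" "t \<in> {0..<1}" "s < t"
    and D: "{s<..t} \<inter> {x\<^sub>1, x\<^sub>2, 1 - \<alpha>, 1 - \<alpha> - (x\<^sub>2 - x\<^sub>1)} = {}"
  show H: "t \<in> hole x\<^sub>1 x\<^sub>2 \<longleftrightarrow> s \<in> hole x\<^sub>1 x\<^sub>2"
    using st D by (auto simp: hole_def)
  \<comment> \<open>The absence of breakpoints becomes linear alternatives, which force
    \<open>s\<close> and \<open>t\<close> into the same branch.\<close>
  have "x\<^sub>1 \<le> s \<or> t < x\<^sub>1" "x\<^sub>2 \<le> s \<or> t < x\<^sub>2" "1 - \<alpha> \<le> s \<or> t < 1 - \<alpha>"
    "1 - \<alpha> - (x\<^sub>2 - x\<^sub>1) \<le> s \<or> t < 1 - \<alpha> - (x\<^sub>2 - x\<^sub>1)"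
    using st D by auto
  moreover assume "s \<notin> hole x\<^sub>1 x\<^sub>2"
  ultimately show "pl_map \<alpha> x\<^sub>1 x\<^sub>2 t = pl_map \<alpha> x\<^sub>1 x\<^sub>2 s + (t - s)"
    using st H params by (simp add: pl_map_off_hole Let_def hole_def) argo
next
  fix p assume "p \<in> gap \<alpha> (x\<^sub>2 - x\<^sub>1)"
  then consider "\<alpha> \<le> p" "p < min 1 (\<alpha> + (x\<^sub>2 - x\<^sub>1))" | "0 \<le> p" "p < \<alpha> + (x\<^sub>2 - x\<^sub>1) - 1"
    by (auto simp: gap_def)
  then show "\<exists>e>0. {p..<p + e} \<subseteq> gap \<alpha> (x\<^sub>2 - x\<^sub>1)"
  proof cases
    case 1
    then show ?thesis
      by (intro exI[of _ "min 1 (\<alpha> + (x\<^sub>2 - x\<^sub>1)) - p"]) (auto simp: gap_def)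
  next
    case 2
    then show ?thesis
      by (intro exI[of _ "\<alpha> + (x\<^sub>2 - x\<^sub>1) - 1 - p"]) (auto simp: gap_def)
  qed
next
  fix t :: real assume "t \<in> {0..<1}" "t \<notin> hole x\<^sub>1 x\<^sub>2"
  then show "pl_map \<alpha> x\<^sub>1 x\<^sub>2 t \<notin> gap \<alpha> (x\<^sub>2 - x\<^sub>1)" by (rule pl_map_notin_gap)
next
  fix t assume "t \<in> gap \<alpha> (x\<^sub>2 - x\<^sub>1)"
  then show "\<exists>l\<in>{0, \<alpha>} \<inter> gap \<alpha> (x\<^sub>2 - x\<^sub>1). l \<le> t \<and> {l..t} \<subseteq> gap \<alpha> (x\<^sub>2 - x\<^sub>1)"
    using params by (auto simp: gap_def)
qed (use params in \<open>auto simp: pl_map_in_unit[simplified] gap_def\<close>)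

text \<open>The first three breakpoints bound the gap; the last two are \<open>x\<^sub>2\<close>
  rotated, where preimages pass from the left piece to the right one.\<close>

lemma backward_escape:
  "interval_escape (pl_inv \<alpha> x\<^sub>1 x\<^sub>2) {0..<1} (gap \<alpha> (x\<^sub>2 - x\<^sub>1)) (hole x\<^sub>1 x\<^sub>2)
     {\<alpha>, \<alpha> + (x\<^sub>2 - x\<^sub>1), \<alpha> + (x\<^sub>2 - x\<^sub>1) - 1, \<alpha> + x\<^sub>2, \<alpha> + x\<^sub>2 - 1} {x\<^sub>1}"
proof
  show "inj_on (pl_inv \<alpha> x\<^sub>1 x\<^sub>2) ({0..<1} - gap \<alpha> (x\<^sub>2 - x\<^sub>1))"
    by (rule inj_on_inverseI[where g = "pl_map \<alpha> x\<^sub>1 x\<^sub>2"]) (auto simp: pl_map_pl_inv)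
next
  fix s t :: real
  assume st: "s \<in> {0..<1}" "t \<in> {0..<1}" "s < t"
    and D: "{s<..t} \<inter> {\<alpha>, \<alpha> + (x\<^sub>2 - x\<^sub>1), \<alpha> + (x\<^sub>2 - x\<^sub>1) - 1, \<alpha> + x\<^sub>2, \<alpha> + x\<^sub>2 - 1} = {}"
  show H: "t \<in> gap \<alpha> (x\<^sub>2 - x\<^sub>1) \<longleftrightarrow> s \<in> gap \<alpha> (x\<^sub>2 - x\<^sub>1)"
    using st D by (auto simp: gap_def)
  have "\<alpha> \<le> s \<or> t < \<alpha>" "\<alpha> + (x\<^sub>2 - x\<^sub>1) \<le> s \<or> t < \<alpha> + (x\<^sub>2 - x\<^sub>1)"
    "\<alpha> + (x\<^sub>2 - x\<^sub>1) - 1 \<le> s \<or> t < \<alpha> + (x\<^sub>2 - x\<^sub>1) - 1"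
    "\<alpha> + x\<^sub>2 \<le> s \<or> t < \<alpha> + x\<^sub>2" "\<alpha> + x\<^sub>2 - 1 \<le> s \<or> t < \<alpha> + x\<^sub>2 - 1"
    using st D by auto
  moreover assume "s \<notin> gap \<alpha> (x\<^sub>2 - x\<^sub>1)"
  ultimately show "pl_inv \<alpha> x\<^sub>1 x\<^sub>2 t = pl_inv \<alpha> x\<^sub>1 x\<^sub>2 s + (t - s)"
    using st H params by (simp add: pl_inv_def Let_def gap_def) argo
next
  fix p assume p: "p \<in> hole x\<^sub>1 x\<^sub>2"
  then show "\<exists>e>0. {p..<p + e} \<subseteq> hole x\<^sub>1 x\<^sub>2"
    by (intro exI[of _ "x\<^sub>2 - p"]) (auto simp: hole_def)
qed (use params pl_inv_off_gap in \<open>auto simp: hole_def\<close>)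

section \<open>The maximal invariant set as an iterated image\<close>

lemma unit_image_funpow:
  "y \<in> {0..<1} \<Longrightarrow> (pl_map \<alpha> x\<^sub>1 x\<^sub>2 ^^ n) y \<in> {0..<1}"
  by (induction n) (auto simp: pl_map_in_unit[simplified])

lemma funpow_on_hole:
  "t \<in> hole x\<^sub>1 x\<^sub>2 \<Longrightarrow> (pl_map \<alpha> x\<^sub>1 x\<^sub>2 ^^ n) t = t"
  by (induction n) (auto simp: pl_map_on_hole)

lemma max_invariant_set_eq_iterate:
  "\<exists>N. max_invariant_set \<alpha> x\<^sub>1 x\<^sub>2 = (pl_map \<alpha> x\<^sub>1 x\<^sub>2 ^^ N) ` {0..<1} - hole x\<^sub>1 x\<^sub>2"
proof -
  let ?M = "pl_map \<alpha> x\<^sub>1 x\<^sub>2" and ?G = "pl_inv \<alpha> x\<^sub>1 x\<^sub>2"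
    and ?H = "hole x\<^sub>1 x\<^sub>2" and ?J = "gap \<alpha> (x\<^sub>2 - x\<^sub>1)"
  obtain N where N: "\<forall>t\<in>?J. \<exists>n\<le>N. (?M ^^ n) t \<in> ?H"
    using interval_escape.enters_hole_bounded[OF forward_escape] ..
  \<comment> \<open>\<open>?H\<close> is fixed pointwise, so whatever enters it by time
    \<open>N\<close> is there at time \<open>N\<close>.\<close>
  have J_absorbed: "(?M ^^ N) t \<in> ?H" if t: "t \<in> ?J" for t
  proof -
    obtain n where n: "n \<le> N" "(?M ^^ n) t \<in> ?H" using N t by blast
    have "(?M ^^ N) t = (?M ^^ (N - n + n)) t" using n(1) by simp
    also have "\<dots> = (?M ^^ n) t" by (simp only: funpow_add comp_apply funpow_on_hole[OF n(2)])
    finally show ?thesis using n(2) by simp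
  qed
  define A where "A = (?M ^^ N) ` {0..<1} - ?H"
  have A_unit: "A \<subseteq> {0..<1} - ?H" using unit_image_funpow by (auto simp: A_def)
  \<comment> \<open>As \<open>?J\<close> is absorbed by time \<open>N\<close>, the starting point
    \<open>y\<close> avoids it and has a preimage \<open>z\<close>; then \<open>(?M ^^ N) z\<close>
    is the preimage of \<open>x\<close> sought.\<close>
  have "A \<subseteq> ?M ` A"
  proof
    fix x assume x: "x \<in> A"
    then obtain y where y: "y \<in> {0..<1}" "x = (?M ^^ N) y" "x \<notin> ?H" by (auto simp: A_def)
    then have "y \<notin> ?J" using J_absorbed by auto
    then obtain z where z: "z \<in> {0..<1}" "y = ?M z"
      using that[of "?G y"] pl_map_pl_inv[OF y(1)] pl_inv_off_gap[OF y(1)] by simp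
    then have eq: "x = ?M ((?M ^^ N) z)" using y(2) by (simp only: funpow_swap1)
    then have "(?M ^^ N) z \<notin> ?H" using y(3) pl_map_on_hole by auto
    then show "x \<in> ?M ` A" using eq z by (auto simp: A_def)
  qed
  have A_back: "?G x \<in> A" "x \<notin> ?J" if x: "x \<in> A" for x
  proof -
    obtain w where w: "w \<in> A" "x = ?M w" using \<open>A \<subseteq> ?M ` A\<close> x by blast
    then have "w \<in> {0..<1}" "w \<notin> ?H" using A_unit by blast+
    then show "?G x \<in> A" "x \<notin> ?J"
      using w pl_inv_pl_map pl_map_notin_gap by simp_all
  qed
  \<comment> \<open>If \<open>?M x\<close> fell into \<open>?H\<close>, its backward orbit would
    reach \<open>?J\<close>. But \<open>?M x\<close> is not in \<open>?J\<close>, and from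
    \<open>x\<close> on that orbit stays in \<open>A\<close>, which misses
    \<open>?J\<close>.\<close>
  have "?M ` A \<subseteq> A"
  proof clarify
    fix x assume x: "x \<in> A"
    then obtain y where y: "y \<in> {0..<1}" "x = (?M ^^ N) y" by (auto simp: A_def)
    have "?M x \<notin> ?H"
    proof
      assume "?M x \<in> ?H"
      then obtain n where n: "(?G ^^ n) (?M x) \<in> ?J"
        using interval_escape.enters_hole[OF backward_escape] by blast
      have "x \<in> {0..<1}" "x \<notin> ?H" using x A_unit by blast+
      then have "?M x \<notin> ?J" "?G (?M x) = x"
        by (rule pl_map_notin_gap, rule pl_inv_pl_map)
      then obtain k where "(?G ^^ k) x \<in> ?J"
        using n by (cases n) (auto simp: funpow_swap1)
      moreover have "(?G ^^ k) x \<in> A" by (induction k) (auto simp: x A_back)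
      ultimately show False using A_back by blast
    qed
    moreover have "?M x = (?M ^^ N) (?M y)" using y(2) by (simp only: funpow_swap1)
    ultimately show "?M x \<in> A"
      unfolding A_def using pl_map_in_unit[OF y(1)] by blast
  qed
  with \<open>A \<subseteq> ?M ` A\<close> have "A \<subseteq> max_invariant_set \<alpha> x\<^sub>1 x\<^sub>2"
    using max_invariant_set_greatest A_unit by blast
  \<comment> \<open>An invariant set is its own image under every iterate, hence inside that of the
    unit interval.\<close>
  moreover have "max_invariant_set \<alpha> x\<^sub>1 x\<^sub>2 \<subseteq> A"
  proof -
    let ?S = "max_invariant_set \<alpha> x\<^sub>1 x\<^sub>2"
    have "(?M ^^ n) ` ?S = ?S" for n
      by (induction n) (simp, simp only: funpow.simps image_comp[symmetric]
        max_invariant_set_invariant)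
    from this[of N] show ?thesis
      using max_invariant_set_subset[of \<alpha> x\<^sub>1 x\<^sub>2] unfolding A_def by blast
  qed
  ultimately show ?thesis unfolding A_def by blast
qed

end

theorem theorem1p3:
  fixes \<alpha> x\<^sub>1 x\<^sub>2 :: real
  assumes "0 \<le> \<alpha>" and "\<alpha> < 1"
    and "0 \<le> x\<^sub>1" and "x\<^sub>1 < x\<^sub>2" and "x\<^sub>2 \<le> 1"
  shows "\<exists>N::nat. max_invariant_set \<alpha> x\<^sub>1 x\<^sub>2
           = (pl_map \<alpha> x\<^sub>1 x\<^sub>2 ^^ N) ` {0..<1} - hole x\<^sub>1 x\<^sub>2"
  using max_invariant_set_eq_iterate[OF assms] .

end
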